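(* Let $\lambda$ be a nonzero real number. For all integers $n\ge0$ and $k\ge1$, $$T_{k,\lambda}(n)=\frac{(-1)^{n}}{2}(n+1)_{k,\lambda}+\big(1+(-1)^{n}\big)\sum_{j=1}^{k}(-1)^{j}j!\Big(\frac{1}{2}\Big)^{j+1}S_{2,\lambda}(k,j)+(-1)^{n}\sum_{j=1}^{k-1}\binom{k}{j}(n+1)_{k-j,\lambda}\sum_{i=1}^{j}(-1)^{i}i!\Big(\frac{1}{2}\Big)^{i+1}S_{2,\lambda}(j,i).$$
   Context: For nonzero real $\lambda$: $(x)_{0,\lambda}=1$, $(x)_{n,\lambda}=x(x-\lambda)\cdots(x-(n-1)\lambda)$ for $n\ge1$. The ordinary falling factorial is $(x)_0=1$, $(x)_k=x(x-1)\cdots(x-k+1)$. The degenerate Stirling numbers of the second kind $S_{2,\lambda}(n,k)$ are defined by $(x)_{n,\lambda}=\sum_{k=0}^{n}S_{2,\lambda}(n,k)(x)_{k}$. The alternating degenerate power sum of integers is $T_{k,\lambda}(n)=\sum_{i=0}^{n}(-1)^{i}(i)_{k,\lambda}$ for integers $k,n\ge0$. *)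

theory Defs
  imports Complex_Main
begin

definition falling_fact :: "real \<Rightarrow> nat \<Rightarrow> real" where
  "falling_fact x k = (\<Prod>i<k. x - real i)"

definition deg_falling_fact :: "real \<Rightarrow> real \<Rightarrow> nat \<Rightarrow> real" where
  "deg_falling_fact lam x n = (\<Prod>i<n. x - real i * lam)"

text \<open>The coefficients are determined only for indices up to \<open>n\<close>; requiring them to
  vanish beyond \<open>n\<close> makes the described function unique (see \<open>deg_Stirling2_ex1\<close>).\<close>

definition deg_Stirling2 :: "real \<Rightarrow> nat \<Rightarrow> nat \<Rightarrow> real" where
  "deg_Stirling2 lam n =
     (THE S. (\<forall>x. deg_falling_fact lam x n = (\<Sum>k=0..n. S k * falling_fact x k)) \<and>
             (\<forall>k>n. S k = 0))"

definition alt_deg_power_sum :: "real \<Rightarrow> nat \<Rightarrow> nat \<Rightarrow> real" where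
  "alt_deg_power_sum lam k n = (\<Sum>i=0..n. (-1) ^ i * deg_falling_fact lam (real i) k)"

lemma falling_fact_Suc: "falling_fact x (Suc k) = falling_fact x k * (x - real k)"
  by (simp add: falling_fact_def)

lemma falling_fact_of_nat_eq_0: "m < k \<Longrightarrow> falling_fact (real m) k = 0"
  by (auto simp: falling_fact_def)

lemma falling_fact_of_nat_nonzero: "falling_fact (real m) m \<noteq> 0"
  by (auto simp: falling_fact_def)

lemma falling_fact_expansion_unique:
  assumes "\<And>x. (\<Sum>k=0..n. a k * falling_fact x k) = (\<Sum>k=0..n. b k * falling_fact x k)"
    and "m \<le> n"
  shows "a m = b m"
  using \<open>m \<le> n\<close>
proof (induction m rule: less_induct)
  case (less m)
  have split: "(\<Sum>k=0..n. c k * falling_fact (real m) k)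
      = (\<Sum>k<m. c k * falling_fact (real m) k) + c m * falling_fact (real m) m"
    for c :: "nat \<Rightarrow> real"
  proof -
    have "(\<Sum>k=0..n. c k * falling_fact (real m) k) = (\<Sum>k\<in>{..<Suc m}. c k * falling_fact (real m) k)"
      by (rule sum.mono_neutral_right)
        (use less.prems in \<open>auto simp: falling_fact_of_nat_eq_0\<close>)
    then show ?thesis by simp
  qed
  have "(\<Sum>k<m. a k * falling_fact (real m) k) = (\<Sum>k<m. b k * falling_fact (real m) k)"
    using less by (intro sum.cong) auto
  then have "a m * falling_fact (real m) m = b m * falling_fact (real m) m"
    using assms(1)[of "real m"] by (simp add: split)
  then show ?case
    using falling_fact_of_nat_nonzero by simp
qed

lemma deg_falling_fact_expansion_exists:
  "\<exists>S. (\<forall>x. deg_falling_fact lam x n = (\<Sum>k=0..n. S k * falling_fact x k)) \<and> (\<forall>k>n. S k = 0)"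
proof (induction n)
  case 0
  show ?case
    by (rule exI[of _ "\<lambda>k. if k = 0 then 1 else 0"])
      (auto simp: deg_falling_fact_def falling_fact_def)
next
  case (Suc n)
  then obtain S where S: "\<And>x. deg_falling_fact lam x n = (\<Sum>k=0..n. S k * falling_fact x k)"
    and S0: "\<And>k. k > n \<Longrightarrow> S k = 0"
    by blast
  define R where "R k = (if k = 0 then 0 else S (k - 1)) + (real k - real n * lam) * S k" for k
  have "deg_falling_fact lam x (Suc n) = (\<Sum>k=0..Suc n. R k * falling_fact x k)" for x
  proof -
    have "deg_falling_fact lam x (Suc n)
        = (\<Sum>k=0..n. S k * falling_fact x k) * (x - real n * lam)"
      by (simp add: deg_falling_fact_def flip: S)
    also have "\<dots> = (\<Sum>k=0..n. S k * falling_fact x (Suc k)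
        + (real k - real n * lam) * S k * falling_fact x k)"
      unfolding sum_distrib_right by (rule sum.cong) (simp_all add: falling_fact_Suc algebra_simps)
    also have "\<dots> = (\<Sum>k=0..n. S k * falling_fact x (Suc k))
        + (\<Sum>k=0..Suc n. (real k - real n * lam) * S k * falling_fact x k)"
      by (simp add: sum.distrib S0)
    also have "(\<Sum>k=0..n. S k * falling_fact x (Suc k))
        = (\<Sum>k=0..Suc n. (if k = 0 then 0 else S (k - 1)) * falling_fact x k)"
      by (subst sum.atLeast0_atMost_Suc_shift) simp
    finally show ?thesis
      by (simp only: R_def distrib_right sum.distrib)
  qed
  moreover have "\<forall>k>Suc n. R k = 0"
    by (simp add: R_def S0)
  ultimately show ?case by blast
qed

lemma deg_Stirling2_ex1:
  "\<exists>!S. (\<forall>x. deg_falling_fact lam x n = (\<Sum>k=0..n. S k * falling_fact x k)) \<and> (\<forall>k>n. S k = 0)"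
proof (rule ex_ex1I[OF deg_falling_fact_expansion_exists])
  fix S R :: "nat \<Rightarrow> real"
  assume S: "(\<forall>x. deg_falling_fact lam x n = (\<Sum>k=0..n. S k * falling_fact x k)) \<and> (\<forall>k>n. S k = 0)"
    and R: "(\<forall>x. deg_falling_fact lam x n = (\<Sum>k=0..n. R k * falling_fact x k)) \<and> (\<forall>k>n. R k = 0)"
  show "S = R"
  proof
    fix m
    show "S m = R m"
    proof (cases "m \<le> n")
      case True
      have "(\<Sum>k=0..n. S k * falling_fact x k) = (\<Sum>k=0..n. R k * falling_fact x k)" for x
        using S R by metis
      then show ?thesis using True by (rule falling_fact_expansion_unique)
    next
      case False
      then show ?thesis using S R by simp
    qed
  qed
qed

lemma deg_falling_fact_eq_sum_Stirling2:
  "deg_falling_fact lam x n = (\<Sum>k=0..n. deg_Stirling2 lam n k * falling_fact x k)"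
  using theI'[OF deg_Stirling2_ex1[of lam n]] unfolding deg_Stirling2_def by blast

lemma deg_Stirling2_eq_0: "n < k \<Longrightarrow> deg_Stirling2 lam n k = 0"
  using theI'[OF deg_Stirling2_ex1[of lam n]] unfolding deg_Stirling2_def by blast

end

(* Let L be the linear functional on polynomials with L((x)_i) = (-1)^i i! (1/2)^(i+1), written
   through Newton's formula as the sum of (-1)^m (1/2)^(m+1) (Delta^m f)(0).  Summing
   Delta^(m+1) f + 2 Delta^m f telescopes to L(f(x+1)) + L(f) = f(0), so E(y) = L((x+y)_{k,lam})
   satisfies E(y+1) + E(y) = (y)_{k,lam} and the alternating power sum equals
   E(0) + (-1)^n E(n+1).  The degenerate Vandermonde identity expands E into the Stirling sums. *)

theory Submission
  imports Defs
begin

definition forward_diff :: "(real \<Rightarrow> real) \<Rightarrow> real \<Rightarrow> real" where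
  "forward_diff f x = f (x + 1) - f x"

lemma forward_diff_pow_Suc:
  "(forward_diff ^^ Suc m) f x = (forward_diff ^^ m) f (x + 1) - (forward_diff ^^ m) f x"
  by (simp add: forward_diff_def)

lemma forward_diff_pow_shift:
  "(forward_diff ^^ m) (\<lambda>x. f (x + a)) x = (forward_diff ^^ m) f (x + a)"
  by (induction m arbitrary: x) (simp_all add: forward_diff_def add_ac)

lemma forward_diff_pow_cmult:
  "(forward_diff ^^ m) (\<lambda>x. c * f x) x = c * (forward_diff ^^ m) f x"
  by (induction m arbitrary: x) (simp_all add: forward_diff_def right_diff_distrib)

lemma forward_diff_pow_sum:
  "(forward_diff ^^ m) (\<lambda>x. \<Sum>j\<in>A. f j x) x = (\<Sum>j\<in>A. (forward_diff ^^ m) (f j) x)"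
  by (induction m arbitrary: x) (simp_all add: forward_diff_def sum_subtractf)

lemma falling_fact_0_Suc: "falling_fact 0 (Suc i) = 0"
  using falling_fact_of_nat_eq_0[of 0 "Suc i"] by simp

text \<open>The truncated index \<open>i - 1\<close> is harmless at \<open>i = 0\<close>, where the
  factor \<open>real i\<close> is zero.\<close>

lemma forward_diff_falling_fact:
  "forward_diff (\<lambda>x. falling_fact x i) = (\<lambda>x. real i * falling_fact x (i - 1))"
proof (cases i)
  case 0
  then show ?thesis by (simp add: forward_diff_def falling_fact_def fun_eq_iff)
next
  case (Suc i')
  have "falling_fact (x + 1) (Suc i') = (x + 1) * falling_fact x i'" for x
    unfolding falling_fact_def prod.lessThan_Suc_shift by simp
  then show ?thesis
    using Suc by (simp add: forward_diff_def fun_eq_iff falling_fact_Suc algebra_simps)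
qed

lemma forward_diff_pow_falling_fact_at_0:
  "(forward_diff ^^ m) (\<lambda>x. falling_fact x i) 0 = (if m = i then fact i else 0)"
proof (induction m arbitrary: i)
  case 0
  show ?case by (cases i) (auto simp: falling_fact_0_Suc, simp add: falling_fact_def)
next
  case (Suc m)
  have "(forward_diff ^^ Suc m) (\<lambda>x. falling_fact x i) 0
      = real i * (forward_diff ^^ m) (\<lambda>x. falling_fact x (i - 1)) 0"
    \<comment> \<open>The innermost difference is taken first: it lowers \<open>i\<close> by one, so
      the induction hypothesis applies to \<open>i - 1\<close>.\<close>
    by (simp add: funpow_swap1[of forward_diff m] forward_diff_falling_fact forward_diff_pow_cmult)
  then show ?case
    using Suc.IH[of "i - 1"] by (cases i) auto
qed

text \<open>Differences at 0 read off coefficients in the falling factorial basis. For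
  \<open>m > k\<close> both sides vanish.\<close>

lemma forward_diff_pow_deg_falling_fact_at_0:
  "(forward_diff ^^ m) (\<lambda>x. deg_falling_fact lam x k) 0 = fact m * deg_Stirling2 lam k m"
proof -
  have "(forward_diff ^^ m) (\<lambda>x. deg_falling_fact lam x k) 0
      = (\<Sum>j=0..k. deg_Stirling2 lam k j * (if m = j then fact j else 0))"
    unfolding deg_falling_fact_eq_sum_Stirling2
    by (simp only: forward_diff_pow_sum forward_diff_pow_cmult forward_diff_pow_falling_fact_at_0)
  also have "\<dots> = (\<Sum>j=0..k. if m = j then fact m * deg_Stirling2 lam k m else 0)"
    by (rule sum.cong) auto
  also have "\<dots> = fact m * deg_Stirling2 lam k m"
    by (auto simp: deg_Stirling2_eq_0)
  finally show ?thesis .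
qed

text \<open>Truncation at \<open>N\<close> makes the sum finite for arbitrary \<open>f\<close>; on
  polynomials of degree at most \<open>N\<close> it agrees with L, as their higher differences are
  zero.\<close>

definition alt_functional :: "nat \<Rightarrow> (real \<Rightarrow> real) \<Rightarrow> real" where
  "alt_functional N f = (\<Sum>m=0..N. (-1) ^ m * (1 / 2) ^ (m + 1) * (forward_diff ^^ m) f 0)"

text \<open>The last summand is the boundary term that truncation leaves after telescoping.\<close>

lemma alt_functional_shift:
  "alt_functional N (\<lambda>x. f (x + 1)) + alt_functional N f
    = f 0 + (-1) ^ N * (1 / 2) ^ (N + 1) * (forward_diff ^^ Suc N) f 0"
proof (induction N)
  case 0
  show ?case by (simp add: alt_functional_def forward_diff_def field_simps)
next
  case (Suc N)
  have step: "alt_functional (Suc N) g = alt_functional N g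
      + (-1) ^ Suc N * (1 / 2) ^ (Suc N + 1) * (forward_diff ^^ Suc N) g 0" for g
    by (simp add: alt_functional_def)
  have shift: "(forward_diff ^^ Suc N) (\<lambda>x. f (x + 1)) 0
      = (forward_diff ^^ Suc (Suc N)) f 0 + (forward_diff ^^ Suc N) f 0"
    unfolding forward_diff_pow_shift forward_diff_pow_Suc[of "Suc N"] by simp
  show ?case
    using Suc.IH unfolding step shift by (simp add: algebra_simps del: funpow.simps)
qed

lemma alt_functional_sum_cmult:
  "alt_functional N (\<lambda>x. \<Sum>j\<in>A. c j * f j x) = (\<Sum>j\<in>A. c j * alt_functional N (f j))"
  unfolding alt_functional_def forward_diff_pow_sum forward_diff_pow_cmult sum_distrib_left
  by (subst sum.swap) (simp add: mult_ac)

text \<open>The terms with index above \<open>j\<close> vanish, so a single truncation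
  \<open>N = k\<close> serves every \<open>j \<le> k\<close>.\<close>

lemma alt_functional_deg_falling_fact:
  assumes "j \<le> N"
  shows "alt_functional N (\<lambda>x. deg_falling_fact lam x j)
    = (\<Sum>i=0..j. (-1) ^ i * fact i * (1 / 2) ^ (i + 1) * deg_Stirling2 lam j i)"
  unfolding alt_functional_def forward_diff_pow_deg_falling_fact_at_0
  by (rule sum.mono_neutral_cong_right) (use assms in \<open>auto simp: deg_Stirling2_eq_0\<close>)

lemma deg_falling_fact_0_left: "0 < k \<Longrightarrow> deg_falling_fact lam 0 k = 0"
  by (auto simp: deg_falling_fact_def)

lemma deg_Stirling2_0_right: "0 < k \<Longrightarrow> deg_Stirling2 lam k 0 = 0"
  using forward_diff_pow_deg_falling_fact_at_0[of 0 lam k] by (simp add: deg_falling_fact_0_left)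

text \<open>Each factor is \<open>x - i * lam = - lam * (- x / lam + i)\<close>; this reduces the
  degenerate Vandermonde identity to the one for \<open>pochhammer\<close>.\<close>

lemma deg_falling_fact_eq_pochhammer:
  assumes "lam \<noteq> 0"
  shows "deg_falling_fact lam x n = (- lam) ^ n * pochhammer (- x / lam) n"
  by (induction n) (use assms in \<open>simp_all add: deg_falling_fact_def pochhammer_Suc field_simps\<close>)

lemma deg_falling_fact_add:
  assumes "lam \<noteq> 0"
  shows "deg_falling_fact lam (x + y) k
    = (\<Sum>j=0..k. real (k choose j) * deg_falling_fact lam y (k - j) * deg_falling_fact lam x j)"
proof -
  have "deg_falling_fact lam (x + y) k = (- lam) ^ k * pochhammer (- x / lam + - y / lam) k"
    using assms by (simp add: deg_falling_fact_eq_pochhammer diff_divide_distrib)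
  \<comment> \<open>Writing \<open>k\<close> as \<open>j + (k - j)\<close> lets the power of
    \<open>- lam\<close> be shared between the two Pochhammer factors.\<close>
  also have "\<dots> = (\<Sum>j=0..k. (- lam) ^ (j + (k - j)) * (real (k choose j)
      * pochhammer (- x / lam) j * pochhammer (- y / lam) (k - j)))"
    unfolding pochhammer_binomial_sum sum_distrib_left atMost_atLeast0 by (rule sum.cong) auto
  also have "\<dots> = (\<Sum>j=0..k. real (k choose j) * deg_falling_fact lam y (k - j) * deg_falling_fact lam x j)"
    unfolding deg_falling_fact_eq_pochhammer[OF assms] power_add by (simp add: mult_ac)
  finally show ?thesis .
qed

lemma alternating_sum_telescope:
  fixes E p :: "real \<Rightarrow> real"
  assumes "\<And>y. E (y + 1) + E y = p y"
  shows "(\<Sum>i=0..n. (-1) ^ i * p (real i)) = E 0 + (-1) ^ n * E (real n + 1)"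
proof (induction n)
  case 0
  show ?case using assms[of 0] by simp
next
  case (Suc n)
  then show ?case
    using assms[of "real n + 1"] by (simp add: algebra_simps flip: assms)
qed

theorem theorem9:
  fixes lam :: real and n k :: nat
  assumes "lam \<noteq> 0" and "k \<ge> 1"
  shows "alt_deg_power_sum lam k n =
      (-1) ^ n / 2 * deg_falling_fact lam (real n + 1) k
    + (1 + (-1) ^ n) * (\<Sum>j=1..k. (-1) ^ j * fact j * (1 / 2) ^ (j + 1) * deg_Stirling2 lam k j)
    + (-1) ^ n * (\<Sum>j=1..k - 1. real (k choose j) * deg_falling_fact lam (real n + 1) (k - j)
        * (\<Sum>i=1..j. (-1) ^ i * fact i * (1 / 2) ^ (i + 1) * deg_Stirling2 lam j i))"
proof -
  define E where "E y = alt_functional k (\<lambda>x. deg_falling_fact lam (x + y) k)" for y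
  define e where "e j = (\<Sum>i=1..j. (-1) ^ i * fact i * (1 / 2) ^ (i + 1) * deg_Stirling2 lam j i)" for j
  let ?a = "\<lambda>j. alt_functional k (\<lambda>x. deg_falling_fact lam x j)"
  \<comment> \<open>This value L(1) produces the leading term with factor
    \<open>(-1) ^ n / 2\<close>.\<close>
  have a0: "?a 0 = 1 / 2"
    using forward_diff_pow_deg_falling_fact_at_0[of 0 lam 0]
    unfolding alt_functional_deg_falling_fact[OF le0] by (simp add: deg_falling_fact_def)
  \<comment> \<open>For positive \<open>j\<close> the term \<open>i = 0\<close> drops out, so the
    inner sums may start at 1.\<close>
  have a: "?a j = e j" if "0 < j" "j \<le> k" for j
    unfolding alt_functional_deg_falling_fact[OF that(2)] e_def
    by (simp add: sum.atLeast_Suc_atMost deg_Stirling2_0_right[OF that(1)])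
  have expand: "E y = (\<Sum>j=0..k. real (k choose j) * deg_falling_fact lam y (k - j) * ?a j)" for y
    unfolding E_def deg_falling_fact_add[OF assms(1)] by (rule alt_functional_sum_cmult)
  have "E (y + 1) + E y = deg_falling_fact lam y k" for y
  proof -
    \<comment> \<open>The boundary term vanishes: in \<open>x\<close> the polynomial has degree
      \<open>k\<close>, so its difference of order \<open>k + 1\<close> is zero.\<close>
    have "(forward_diff ^^ Suc k) (\<lambda>x. deg_falling_fact lam (x + y) k) 0 = 0"
      unfolding deg_falling_fact_add[OF assms(1)] forward_diff_pow_sum forward_diff_pow_cmult
        forward_diff_pow_deg_falling_fact_at_0
      by (rule sum.neutral) (simp add: deg_Stirling2_eq_0)
    then show ?thesis
      using alt_functional_shift[of k "\<lambda>x. deg_falling_fact lam (x + y) k"]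
      by (simp add: E_def add_ac)
  qed
  then have "alt_deg_power_sum lam k n = E 0 + (-1) ^ n * E (real n + 1)"
    unfolding alt_deg_power_sum_def by (rule alternating_sum_telescope)
  moreover have "E 0 = e k"
    using a[of k] assms(2) by (simp add: E_def)
  \<comment> \<open>The end terms \<open>j = 0\<close> and \<open>j = k\<close> are split off. The
    \<open>e k\<close> here, at \<open>y = n + 1\<close>, joins \<open>E 0 = e k\<close> to give the
    factor \<open>1 + (-1) ^ n\<close>.\<close>
  moreover have "E y = deg_falling_fact lam y k / 2 + e k
      + (\<Sum>j=1..k - 1. real (k choose j) * deg_falling_fact lam y (k - j) * e j)" for y
  proof -
    obtain k' where k': "k = Suc k'"
      using assms(2) by (cases k) auto
    have "E y = deg_falling_fact lam y k / 2
        + (\<Sum>j=1..k. real (k choose j) * deg_falling_fact lam y (k - j) * e j)"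
      unfolding expand by (simp add: sum.atLeast_Suc_atMost a0 a)
    then show ?thesis
      by (simp add: k' deg_falling_fact_def)
  qed
  ultimately show ?thesis
    unfolding e_def by (simp add: algebra_simps)
qed

end
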